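(* Let $(X_n,b_n)_{n\in\mathbb{N}}$ be a sequence of pointed proper injective metric spaces converging, in the sense of pointed Gromov--Hausdorff convergence, to a pointed metric space $(X,b)$ with $X$ complete. Then $X$ is injective.
   Context: A metric space is proper if its closed bounded subsets are compact. A metric space $X$ is injective if for every isometric embedding $i:A\to C$ of metric spaces and every non-expansive (1-Lipschitz) map $f:A\to X$ there is a non-expansive map $F:C\to X$ with $F\circ i=f$. For $\epsilon>0$, an $\epsilon$-approximation between metric spaces $X,Y$ is a relation $R\subseteq X\times Y$ whose projections to $X$ and to $Y$ are $\epsilon$-dense (closed balls of radius $\epsilon$ about their points cover) and such that $|d(x,x')-d(y,y')|<\epsilon$ for all $(x,y),(x',y')\in R$. A sequence $X_n$ converges to $X$ in the Gromov--Hausdorff sense if for every $\epsilon>0$ there is $N$ such that for all $n\ge N$ there is an $\epsilon$-approximation between $X_n$ and $X$. A sequence $(X_n,b_n)$ of pointed proper metric spaces converges to $(X,b)$ in the pointed sense if for every $R>0$ the closed balls $B_{X_n}(b_n,R)$ converge in the Gromov--Hausdorff sense to the closed ball $B_X(b,R)$. *)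

theory Defs
  imports "HOL-Analysis.Analysis" "HOL-Library.Infinite_Typeclass"
begin

definition proper_metric :: "'a metric \<Rightarrow> bool" where
  "proper_metric X \<longleftrightarrow>
     (\<forall>S. closedin (mtopology_of X) S \<and> Metric_space.mbounded (mspace X) (mdist X) S
          \<longrightarrow> compactin (mtopology_of X) S)"

definition nonexpansive_map :: "'a metric \<Rightarrow> 'b metric \<Rightarrow> ('a \<Rightarrow> 'b) \<Rightarrow> bool" where
  "nonexpansive_map X Y f \<longleftrightarrow>
     f \<in> mspace X \<rightarrow> mspace Y \<and>
     (\<forall>x\<in>mspace X. \<forall>x'\<in>mspace X. mdist Y (f x) (f x') \<le> mdist X x x')"

definition isometric_embedding :: "'a metric \<Rightarrow> 'b metric \<Rightarrow> ('a \<Rightarrow> 'b) \<Rightarrow> bool" where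
  "isometric_embedding X Y i \<longleftrightarrow>
     i \<in> mspace X \<rightarrow> mspace Y \<and>
     (\<forall>x\<in>mspace X. \<forall>x'\<in>mspace X. mdist Y (i x) (i x') = mdist X x x')"

text \<open>
  The definition of injectivity quantifies over all metric spaces \<open>A\<close> and \<open>C\<close>. A HOL definition
  cannot quantify over types, so the types \<open>'c\<close> and \<open>'d\<close> holding the points of \<open>A\<close> and \<open>C\<close> are
  parameters; a space is injective if this holds for all choices of \<open>'c\<close> and \<open>'d\<close>.
  For a nonempty proper space, a compactness argument reduces the extension property to finite
  \<open>A\<close> and \<open>C\<close>, so any single choice of infinite types \<open>'c\<close> and \<open>'d\<close> already gives all others.
\<close>

definition injective_metric :: "'c itself \<Rightarrow> 'd itself \<Rightarrow> 'a metric \<Rightarrow> bool" where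
  "injective_metric _ _ X \<longleftrightarrow>
     (\<forall>(A :: 'c metric) (C :: 'd metric) i f.
        isometric_embedding A C i \<and> nonexpansive_map A X f \<longrightarrow>
        (\<exists>F. nonexpansive_map C X F \<and> (\<forall>a\<in>mspace A. F (i a) = f a)))"

definition eps_dense :: "'a metric \<Rightarrow> real \<Rightarrow> 'a set \<Rightarrow> bool" where
  "eps_dense X \<epsilon> S \<longleftrightarrow> S \<subseteq> mspace X \<and> mspace X \<subseteq> (\<Union>x\<in>S. mcball_of X x \<epsilon>)"

definition eps_approximation :: "real \<Rightarrow> 'a metric \<Rightarrow> 'b metric \<Rightarrow> ('a \<times> 'b) set \<Rightarrow> bool" where
  "eps_approximation \<epsilon> X Y R \<longleftrightarrow>
     R \<subseteq> mspace X \<times> mspace Y \<and>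
     eps_dense X \<epsilon> (fst ` R) \<and> eps_dense Y \<epsilon> (snd ` R) \<and>
     (\<forall>(x, y)\<in>R. \<forall>(x', y')\<in>R. \<bar>mdist X x x' - mdist Y y y'\<bar> < \<epsilon>)"

definition GH_converges :: "(nat \<Rightarrow> 'a metric) \<Rightarrow> 'b metric \<Rightarrow> bool" where
  "GH_converges Xs X \<longleftrightarrow>
     (\<forall>\<epsilon>>0. \<exists>N. \<forall>n\<ge>N. \<exists>R. eps_approximation \<epsilon> (Xs n) X R)"

definition pointed_GH_converges ::
    "(nat \<Rightarrow> 'a metric) \<Rightarrow> (nat \<Rightarrow> 'a) \<Rightarrow> 'b metric \<Rightarrow> 'b \<Rightarrow> bool" where
  "pointed_GH_converges Xs bs X b \<longleftrightarrow>
     (\<forall>r>0. GH_converges (\<lambda>n. submetric (Xs n) (mcball_of (Xs n) (bs n) r))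
                         (submetric X (mcball_of X b r)))"

end

theory Submission
  imports Defs
begin

text \<open>
  The extension problem is translated into an intersection property of closed balls, following
  Aronszajn and Panitchpakdi. Call a family of closed balls linked if the distance between any two
  centres is at most the sum of the two radii; a point common to two balls forces this inequality.
  A common point of a linked family is exactly what is needed to extend a non-expansive map by one
  more point, and Zorn's lemma turns one-point extensions into extensions to the whole space.

  The intersection property passes to the limit for finite families with an arbitrarily small
  enlargement of the radii. Given finitely many linked balls of \<open>X\<close>, all centres lie in one ball
  about \<open>b\<close> of some radius \<open>r\<close>. An approximation between that ball and the ball of radius \<open>r\<close> about
  the base point of \<open>Xs n\<close> carries the centres to \<open>Xs n\<close>, where slightly enlarged balls have a
  common point because \<open>Xs n\<close> is injective. The only danger is that this point leaves the domain
  of the approximation. It can be avoided by adding the ball of radius \<open>r\<close> about the base point to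
  the family: the centres lie in it, so the family stays linked. The common point then travels back
  to \<open>X\<close>.

  The closed balls of \<open>X\<close> are compact: they are complete, and they inherit total boundedness from
  the compact balls of the approximating spaces. Hence the finite intersection property removes
  both the finiteness and the enlargement.

  Injectivity of \<open>Xs n\<close> is known for one choice of infinite carrier types. This suffices, since
  only finite families are transported to \<open>Xs n\<close>, and finite metric spaces have copies in
  every infinite type.
\<close>

section \<open>Linked families of balls\<close>

text \<open>A family of closed balls is encoded as a set of pairs of a centre and a radius, which allows
  concentric balls. Two instances with the same ball show that linked balls have non-negative
  radii.\<close>

definition linked_balls :: "'a metric \<Rightarrow> ('a \<times> real) set \<Rightarrow> bool" where
  "linked_balls X B \<longleftrightarrow>
     fst ` B \<subseteq> mspace X \<and> (\<forall>(x, r)\<in>B. \<forall>(y, s)\<in>B. mdist X x y \<le> r + s)"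

definition common_point :: "'a metric \<Rightarrow> ('a \<times> real) set \<Rightarrow> 'a \<Rightarrow> bool" where
  "common_point X B z \<longleftrightarrow> z \<in> mspace X \<and> (\<forall>(x, r)\<in>B. mdist X z x \<le> r)"

lemma linked_ballsD:
  "linked_balls X B \<Longrightarrow> (x, r) \<in> B \<Longrightarrow> (y, s) \<in> B \<Longrightarrow> mdist X x y \<le> r + s"
  unfolding linked_balls_def by fast

lemma linked_balls_subset: "linked_balls X B \<Longrightarrow> B' \<subseteq> B \<Longrightarrow> linked_balls X B'"
  unfolding linked_balls_def by blast

section \<open>Finite families in an injective space\<close>

lemma metric_copy_along_injection:
  fixes M :: "'a metric" and g :: "'a \<Rightarrow> 'b"
  assumes "inj_on g (mspace M)"
  obtains N where "mspace N = g ` mspace M"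
    and "\<And>x y. x \<in> mspace M \<Longrightarrow> y \<in> mspace M \<Longrightarrow> mdist N (g x) (g y) = mdist M x y"
proof -
  define d where "d p q = mdist M (inv_into (mspace M) g p) (inv_into (mspace M) g q)" for p q
  interpret N: Metric_space "g ` mspace M" d
    by unfold_locales
      (use assms in \<open>auto simp: d_def mdist_commute mdist_triangle inj_on_eq_iff\<close>)
  show thesis
    by (rule that[of "metric (g ` mspace M, d)"]) (use assms in \<open>auto simp: d_def\<close>)
qed

text \<open>Any infinite types have room for copies of finite spaces, so the carrier types fixed in
  the injectivity hypothesis are irrelevant for finite extension problems.\<close>

lemma injective_metric_extends_finite:
  fixes X :: "'a metric" and A :: "'u metric" and C :: "'v metric"
  assumes inj: "injective_metric TYPE('c::infinite) TYPE('d::infinite) X"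
    and fin: "finite (mspace A)" "finite (mspace C)"
    and i: "isometric_embedding A C i" and f: "nonexpansive_map A X f"
  obtains F where "nonexpansive_map C X F" "\<And>a. a \<in> mspace A \<Longrightarrow> F (i a) = f a"
proof -
  obtain g :: "'u \<Rightarrow> 'c" where g: "inj_on g (mspace A)"
    using arb_inj_on_finite_infinite fin(1) by blast
  obtain h :: "'v \<Rightarrow> 'd" where h: "inj_on h (mspace C)"
    using arb_inj_on_finite_infinite fin(2) by blast
  obtain A' where A': "mspace A' = g ` mspace A"
    "\<And>x y. x \<in> mspace A \<Longrightarrow> y \<in> mspace A \<Longrightarrow> mdist A' (g x) (g y) = mdist A x y"
    using metric_copy_along_injection[OF g] by blast
  obtain C' where C': "mspace C' = h ` mspace C"
    "\<And>x y. x \<in> mspace C \<Longrightarrow> y \<in> mspace C \<Longrightarrow> mdist C' (h x) (h y) = mdist C x y"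
    using metric_copy_along_injection[OF h] by blast
  define g' where "g' = inv_into (mspace A) g"
  have g': "g' (g a) = a" if "a \<in> mspace A" for a
    using g that by (simp add: g'_def)
  have iC: "i a \<in> mspace C" if "a \<in> mspace A" for a
    using i that by (auto simp: isometric_embedding_def)
  have "isometric_embedding A' C' (h \<circ> i \<circ> g')"
    using i by (auto simp: isometric_embedding_def A' C' g' iC)
  moreover have "nonexpansive_map A' X (f \<circ> g')"
    using f by (auto simp: nonexpansive_map_def A' g')
  ultimately obtain F where F: "nonexpansive_map C' X F"
    and Ff: "\<And>a. a \<in> mspace A' \<Longrightarrow> F ((h \<circ> i \<circ> g') a) = (f \<circ> g') a"
    using inj unfolding injective_metric_def by blast
  show thesis
  proof
    show "nonexpansive_map C X (F \<circ> h)"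
      using F C' by (auto simp: nonexpansive_map_def Pi_iff)
    show "(F \<circ> h) (i a) = f a" if "a \<in> mspace A" for a
      using Ff[of "g a"] that by (simp add: A' g')
  qed
qed

text \<open>Adjoin to the finite set of centres one new point at distance \<open>\<rho> s = min (r + d x s)\<close> from
  \<open>s\<close>, the minimum being over the balls \<open>(x, r)\<close>. The radii themselves need not satisfy the triangle
  inequality, but \<open>\<rho>\<close> is the largest 1-Lipschitz function bounded by them, and linkedness
  gives \<open>d s t \<le> \<rho> s + \<rho> t\<close>. Extending the inclusion of the centres sends the new point to a common
  point. Positive radii keep the new point apart from the old ones.\<close>

lemma injective_metric_common_point_finite:
  fixes X :: "'a metric"
  assumes inj: "injective_metric TYPE('c::infinite) TYPE('d::infinite) X"
    and fin: "finite B" and ne: "B \<noteq> {}" and B: "linked_balls X B"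
    and pos: "\<And>x r. (x, r) \<in> B \<Longrightarrow> r > 0"
  obtains z where "common_point X B z"
proof -
  let ?S = "fst ` B"
  have S: "?S \<subseteq> mspace X" using B by (simp add: linked_balls_def)
  define \<rho> where "\<rho> s = Min ((\<lambda>(x, r). r + mdist X x s) ` B)" for s
  have \<rho>_le: "\<rho> s \<le> r + mdist X x s" if "(x, r) \<in> B" for x r s
    unfolding \<rho>_def using fin that by (intro Min_le) force+
  have \<rho>_eq: "\<exists>x r. (x, r) \<in> B \<and> \<rho> s = r + mdist X x s" for s
  proof -
    have "\<rho> s \<in> (\<lambda>(x, r). r + mdist X x s) ` B"
      unfolding \<rho>_def using fin ne by (intro Min_in) auto
    then show ?thesis by auto
  qed
  have \<rho>_pos: "\<rho> s > 0" for s
    using \<rho>_eq[of s] pos by (metis add_pos_nonneg mdist_nonneg)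
  have \<rho>_Lip: "\<rho> s \<le> \<rho> t + mdist X t s" if st: "s \<in> ?S" "t \<in> ?S" for s t
  proof -
    obtain x r where x: "(x, r) \<in> B" "\<rho> t = r + mdist X x t" using \<rho>_eq by blast
    have "mdist X x s \<le> mdist X x t + mdist X t s"
      using x S st by (intro mdist_triangle) force+
    then show ?thesis using \<rho>_le[OF x(1), of s] x(2) by linarith
  qed
  have \<rho>_sum: "mdist X s t \<le> \<rho> s + \<rho> t" if st: "s \<in> ?S" "t \<in> ?S" for s t
  proof -
    obtain x r where x: "(x, r) \<in> B" "\<rho> s = r + mdist X x s" using \<rho>_eq by blast
    obtain y q where y: "(y, q) \<in> B" "\<rho> t = q + mdist X y t" using \<rho>_eq by blast
    have mem: "x \<in> mspace X" "y \<in> mspace X" "s \<in> mspace X" "t \<in> mspace X"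
      using x y S st by force+
    have "mdist X x y \<le> r + q" using linked_ballsD[OF B x(1) y(1)] .
    moreover have "mdist X s t \<le> mdist X s x + mdist X x t"
      "mdist X x t \<le> mdist X x y + mdist X y t"
      using mem by (auto intro: mdist_triangle)
    ultimately show ?thesis using x y mdist_commute[of X s x] by linarith
  qed
  define d where "d p q = (case p of
        None \<Rightarrow> (case q of None \<Rightarrow> 0 | Some t \<Rightarrow> \<rho> t)
      | Some s \<Rightarrow> (case q of None \<Rightarrow> \<rho> s | Some t \<Rightarrow> mdist X s t))" for p q
  let ?C = "insert None (Some ` ?S)"
  interpret C: Metric_space ?C d
  proof
    show "0 \<le> d p q" for p q
      using \<rho>_pos by (auto simp: d_def less_imp_le split: option.split)
    show "d p q = d q p" for p q
      by (auto simp: d_def mdist_commute split: option.split)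
    show "d p q = 0 \<longleftrightarrow> p = q" if "p \<in> ?C" "q \<in> ?C" for p q
    proof -
      have "\<rho> s \<noteq> 0" for s using \<rho>_pos[of s] by simp
      moreover have "s \<in> mspace X" if "Some s \<in> ?C" for s using that S by blast
      ultimately show ?thesis using that by (cases p; cases q) (simp_all add: d_def)
    qed
    show "d p q \<le> d p w + d w q" if "p \<in> ?C" "w \<in> ?C" "q \<in> ?C" for p w q
    proof -
      have S_if: "s \<in> ?S" if "Some s \<in> ?C" for s using that by blast
      show ?thesis
      proof (cases p; cases w; cases q)
        fix s t u assume eqs: "p = Some s" "w = Some t" "q = Some u"
        then have "s \<in> ?S" "t \<in> ?S" "u \<in> ?S" using that S_if by blast+
        then have "s \<in> mspace X" "t \<in> mspace X" "u \<in> mspace X" using S by blast+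
        then show ?thesis unfolding eqs by (simp add: d_def mdist_triangle)
      next
        fix s t assume eqs: "p = Some s" "w = None" "q = Some t"
        then have "s \<in> ?S" "t \<in> ?S" using that S_if by blast+
        then have "mdist X s t \<le> \<rho> s + \<rho> t" by (rule \<rho>_sum)
        then show ?thesis unfolding eqs by (simp add: d_def)
      next
        fix s t assume eqs: "p = Some s" "w = Some t" "q = None"
        then have "s \<in> ?S" "t \<in> ?S" using that S_if by blast+
        then have "\<rho> s \<le> \<rho> t + mdist X t s" by (rule \<rho>_Lip)
        then show ?thesis unfolding eqs by (simp add: d_def mdist_commute)
      next
        fix s t assume eqs: "p = None" "w = Some s" "q = Some t"
        then have "t \<in> ?S" "s \<in> ?S" using that S_if by blast+
        then have "\<rho> t \<le> \<rho> s + mdist X s t" by (rule \<rho>_Lip)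
        then show ?thesis unfolding eqs by (simp add: d_def)
      qed (auto simp: d_def less_imp_le[OF \<rho>_pos])
    qed
  qed
  have "isometric_embedding (submetric X ?S) (metric (?C, d)) Some"
    by (auto simp: isometric_embedding_def d_def)
  moreover have "nonexpansive_map (submetric X ?S) X id"
    by (auto simp: nonexpansive_map_def)
  ultimately obtain F where F: "nonexpansive_map (metric (?C, d)) X F"
    and F_id: "\<And>s. s \<in> mspace (submetric X ?S) \<Longrightarrow> F (Some s) = id s"
    using injective_metric_extends_finite[OF inj, of "submetric X ?S" "metric (?C, d)"] fin
    by (metis C.mspace_metric finite_Int finite_imageI finite_insert mspace_submetric)
  have "common_point X B (F None)"
    unfolding common_point_def
  proof safe
    show "F None \<in> mspace X" using F by (auto simp: nonexpansive_map_def)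
    fix x r assume x: "(x, r) \<in> B"
    then have xS: "x \<in> ?S" "x \<in> mspace X" using S by force+
    have "mdist X (F None) (F (Some x)) \<le> d None (Some x)"
      using F xS by (auto simp: nonexpansive_map_def)
    also have "\<dots> \<le> r" using \<rho>_le[OF x, of x] mdist_zero[OF xS(2) xS(2)] by (simp add: d_def)
    finally show "mdist X (F None) x \<le> r" using F_id[of x] xS by simp
  qed
  then show thesis by (rule that)
qed

section \<open>Passing to the limit\<close>

lemma pointed_GH_approximation:
  assumes "pointed_GH_converges Xs bs X b" and "r > 0" and "\<epsilon> > 0"
  obtains n R where "R \<subseteq> mcball_of (Xs n) (bs n) r \<times> mcball_of X b r"
    and "\<And>p. p \<in> mcball_of (Xs n) (bs n) r \<Longrightarrow> \<exists>(u, v)\<in>R. mdist (Xs n) p u \<le> \<epsilon>"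
    and "\<And>q. q \<in> mcball_of X b r \<Longrightarrow> \<exists>(u, v)\<in>R. mdist X q v \<le> \<epsilon>"
    and "\<And>u v u' v'. (u, v) \<in> R \<Longrightarrow> (u', v') \<in> R \<Longrightarrow> \<bar>mdist (Xs n) u u' - mdist X v v'\<bar> < \<epsilon>"
proof -
  have "GH_converges (\<lambda>n. submetric (Xs n) (mcball_of (Xs n) (bs n) r))
                     (submetric X (mcball_of X b r))"
    using assms(1,2) by (simp add: pointed_GH_converges_def)
  then obtain N where "\<forall>n\<ge>N. \<exists>R. eps_approximation \<epsilon>
      (submetric (Xs n) (mcball_of (Xs n) (bs n) r)) (submetric X (mcball_of X b r)) R"
    using assms(3) unfolding GH_converges_def by blast
  then obtain R where R: "eps_approximation \<epsilon> (submetric (Xs N) (mcball_of (Xs N) (bs N) r))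
                            (submetric X (mcball_of X b r)) R"
    by blast
  show thesis
  proof
    show "R \<subseteq> mcball_of (Xs N) (bs N) r \<times> mcball_of X b r"
      using R by (auto simp: eps_approximation_def)
    show "\<exists>(u, v)\<in>R. mdist (Xs N) p u \<le> \<epsilon>" if "p \<in> mcball_of (Xs N) (bs N) r" for p
    proof -
      have "mspace (submetric (Xs N) (mcball_of (Xs N) (bs N) r))
          \<subseteq> (\<Union>x\<in>fst ` R. mcball_of (submetric (Xs N) (mcball_of (Xs N) (bs N) r)) x \<epsilon>)"
        using R unfolding eps_approximation_def eps_dense_def by blast
      moreover have "p \<in> mspace (submetric (Xs N) (mcball_of (Xs N) (bs N) r))" using that by simp
      ultimately obtain w where "w \<in> R"
        "p \<in> mcball_of (submetric (Xs N) (mcball_of (Xs N) (bs N) r)) (fst w) \<epsilon>"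
        by blast
      then show ?thesis by (intro bexI[of _ w]) (auto simp: mdist_commute split: prod.split)
    qed
    show "\<exists>(u, v)\<in>R. mdist X q v \<le> \<epsilon>" if "q \<in> mcball_of X b r" for q
    proof -
      have "mspace (submetric X (mcball_of X b r))
          \<subseteq> (\<Union>x\<in>snd ` R. mcball_of (submetric X (mcball_of X b r)) x \<epsilon>)"
        using R unfolding eps_approximation_def eps_dense_def by blast
      moreover have "q \<in> mspace (submetric X (mcball_of X b r))" using that by simp
      ultimately obtain w where "w \<in> R"
        "q \<in> mcball_of (submetric X (mcball_of X b r)) (snd w) \<epsilon>"
        by blast
      then show ?thesis by (intro bexI[of _ w]) (auto simp: mdist_commute split: prod.split)
    qed
    show "\<bar>mdist (Xs N) u u' - mdist X v v'\<bar> < \<epsilon>" if "(u, v) \<in> R" "(u', v') \<in> R" for u v u' v'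
      using R that by (fastforce simp: eps_approximation_def)
  qed
qed

text \<open>The transported centres \<open>u\<close> are linked for the radii \<open>r + 2 * \<delta>\<close>: moving a centre
  of \<open>X\<close> into the range of the approximation costs \<open>\<delta>\<close> at each end, and the distortion costs
  another \<open>\<delta>\<close>, so that \<open>4 * \<delta>\<close> of slack in two radii is enough. The way back costs \<open>3 * \<delta>\<close>
  more for each ball, hence \<open>\<delta> = \<epsilon> / 5\<close>. The additional ball \<open>(bs n, \<rho>)\<close> keeps the common point in the
  domain of the approximation.\<close>

lemma limit_common_point_finite_enlarged:
  fixes Xs :: "nat \<Rightarrow> 'a metric" and X :: "'b metric"
  assumes base: "\<And>n. bs n \<in> mspace (Xs n)"
    and inj: "\<And>n. injective_metric TYPE('c::infinite) TYPE('d::infinite) (Xs n)"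
    and b: "b \<in> mspace X" and conv: "pointed_GH_converges Xs bs X b"
    and fin: "finite B" and B: "linked_balls X B" and \<epsilon>: "\<epsilon> > 0"
  obtains z where "common_point X ((\<lambda>(x, r). (x, r + \<epsilon>)) ` B) z"
proof -
  define \<rho> where "\<rho> = Max (insert 1 (mdist X b ` fst ` B))"
  have \<rho>_ge: "mdist X b x \<le> \<rho>" if "x \<in> fst ` B" for x
    unfolding \<rho>_def using fin that by (intro Max_ge) auto
  have "1 \<le> \<rho>" unfolding \<rho>_def using fin by (intro Max_ge) auto
  then have \<rho>: "\<rho> > 0" by simp
  define \<delta> where "\<delta> = \<epsilon> / 5"
  have \<delta>: "\<delta> > 0" using \<epsilon> by (simp add: \<delta>_def)
  obtain n R where R: "R \<subseteq> mcball_of (Xs n) (bs n) \<rho> \<times> mcball_of X b \<rho>"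
    and dense_n: "\<And>p. p \<in> mcball_of (Xs n) (bs n) \<rho> \<Longrightarrow> \<exists>(u, v)\<in>R. mdist (Xs n) p u \<le> \<delta>"
    and dense: "\<And>q. q \<in> mcball_of X b \<rho> \<Longrightarrow> \<exists>(u, v)\<in>R. mdist X q v \<le> \<delta>"
    and dist: "\<And>u v u' v'. (u, v) \<in> R \<Longrightarrow> (u', v') \<in> R
                 \<Longrightarrow> \<bar>mdist (Xs n) u u' - mdist X v v'\<bar> < \<delta>"
    by (rule pointed_GH_approximation[OF conv \<rho> \<delta>], rule that) (assumption | blast)+
  have Rmem: "u \<in> mspace (Xs n)" "v \<in> mspace X" "mdist (Xs n) (bs n) u \<le> \<rho>" if "(u, v) \<in> R" for u v
    using R that by auto
  have Bmem: "x \<in> mspace X" if "(x, r) \<in> B" for x r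
    using B that by (force simp: linked_balls_def)
  have "\<exists>p\<in>R. mdist X x (snd p) \<le> \<delta>" if "x \<in> fst ` B" for x
  proof -
    have "x \<in> mcball_of X b \<rho>" using \<rho>_ge[OF that] that b Bmem by auto
    then show ?thesis using dense[of x] by (metis (no_types, lifting) case_prod_unfold)
  qed
  then obtain t where t: "\<And>x. x \<in> fst ` B \<Longrightarrow> t x \<in> R \<and> mdist X x (snd (t x)) \<le> \<delta>"
    by metis
  define u v where "u x = fst (t x)" and "v x = snd (t x)" for x
  have uv: "(u x, v x) \<in> R" "mdist X x (v x) \<le> \<delta>" if "(x, r) \<in> B" for x r
    using t[of x] that by (force simp: u_def v_def)+
  define B' where "B' = insert (bs n, \<rho>) ((\<lambda>(x, r). (u x, r + 2 * \<delta>)) ` B)"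
  have r_nonneg: "0 \<le> r" if "(x, r) \<in> B" for x r
  proof -
    have "mdist X x x \<le> r + r" using linked_ballsD[OF B that that] .
    then show ?thesis using mdist_nonneg[of X x x] by linarith
  qed
  have u_near: "mdist (Xs n) (u x) (u y) \<le> (r + 2 * \<delta>) + (s + 2 * \<delta>)"
    if xr: "(x, r) \<in> B" and ys: "(y, s) \<in> B" for x r y s
  proof -
    have mem: "x \<in> mspace X" "y \<in> mspace X" "v x \<in> mspace X" "v y \<in> mspace X"
      using xr ys Bmem uv Rmem by blast+
    have "mdist X (v x) (v y) \<le> mdist X (v x) x + mdist X x (v y)"
      "mdist X x (v y) \<le> mdist X x y + mdist X y (v y)"
      using mem by (auto intro: mdist_triangle)
    moreover have "mdist X x y \<le> r + s" using linked_ballsD[OF B xr ys] .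
    ultimately show ?thesis
      using dist[OF uv(1)[OF xr] uv(1)[OF ys]] uv(2)[OF xr] uv(2)[OF ys] \<delta>
        mdist_commute[of X x "v x"] by linarith
  qed
  have u_base: "mdist (Xs n) (bs n) (u x) \<le> \<rho> + (r + 2 * \<delta>)"
    "mdist (Xs n) (u x) (bs n) \<le> r + 2 * \<delta> + \<rho>"
    if "(x, r) \<in> B" for x r
    using Rmem(3)[OF uv(1)[OF that]] r_nonneg[OF that] \<delta> mdist_commute[of "Xs n" "u x" "bs n"]
    by linarith+
  have linked': "linked_balls (Xs n) B'"
    unfolding linked_balls_def
  proof (intro conjI)
    show "fst ` B' \<subseteq> mspace (Xs n)"
      using base uv(1) Rmem(1) by (fastforce simp: B'_def)
    have "mdist (Xs n) (bs n) (bs n) \<le> \<rho> + \<rho>" using mdist_zero[OF base base] \<rho> by simp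
    then show "\<forall>(x, r)\<in>B'. \<forall>(y, s)\<in>B'. mdist (Xs n) x y \<le> r + s"
      using u_near u_base unfolding B'_def by auto
  qed
  obtain z' where z': "common_point (Xs n) B' z'"
  proof (rule injective_metric_common_point_finite[OF inj _ _ linked'])
    show "finite B'" "B' \<noteq> {}" using fin by (auto simp: B'_def)
    show "r > 0" if "(x, r) \<in> B'" for x r
      using that \<rho> \<delta> r_nonneg by (fastforce simp: B'_def)
  qed
  have "z' \<in> mcball_of (Xs n) (bs n) \<rho>"
    using z' base by (auto simp: common_point_def B'_def mdist_commute)
  then obtain p q where pq: "(p, q) \<in> R" "mdist (Xs n) z' p \<le> \<delta>"
    using dense_n by blast
  have "common_point X ((\<lambda>(x, r). (x, r + \<epsilon>)) ` B) q"
    unfolding common_point_def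
  proof (intro conjI)
    show "q \<in> mspace X" using pq Rmem by blast
    have "mdist X q x \<le> r + \<epsilon>" if xr: "(x, r) \<in> B" for x r
    proof -
      have mem: "x \<in> mspace X" "v x \<in> mspace X" "q \<in> mspace X"
        "u x \<in> mspace (Xs n)" "p \<in> mspace (Xs n)" "z' \<in> mspace (Xs n)"
        using Bmem[OF xr] Rmem(1,2)[OF uv(1)[OF xr]] Rmem(1,2)[OF pq(1)] z'
        by (auto simp: common_point_def)
      have "mdist (Xs n) z' (u x) \<le> r + 2 * \<delta>"
        using z' xr by (auto simp: common_point_def B'_def)
      moreover have "mdist (Xs n) p (u x) \<le> mdist (Xs n) p z' + mdist (Xs n) z' (u x)"
        "mdist X q x \<le> mdist X q (v x) + mdist X (v x) x"
        using mem by (auto intro: mdist_triangle)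
      ultimately show ?thesis
        using dist[OF pq(1) uv(1)[OF xr]] uv(2)[OF xr] pq(2)
          mdist_commute[of X x "v x"] mdist_commute[of "Xs n" z' p] \<delta>_def
        by linarith
    qed
    then show "\<forall>(x, r)\<in>(\<lambda>(x, r). (x, r + \<epsilon>)) ` B. mdist X q x \<le> r" by auto
  qed
  then show thesis by (rule that)
qed

text \<open>A finite net of an approximating compact ball is carried over by the approximation: the
  points of the range whose partners lie near one net point are near each other, so one of them
  per net point suffices.\<close>

lemma limit_ball_compactin:
  fixes Xs :: "nat \<Rightarrow> 'a metric" and X :: "'b metric"
  assumes proper: "\<And>n. proper_metric (Xs n)"
    and complete: "mcomplete_of X" and conv: "pointed_GH_converges Xs bs X b" and r: "r > 0"
  shows "compactin (mtopology_of X) (mcball_of X b r)"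
proof -
  interpret X: Metric_space "mspace X" "mdist X" by simp
  have "X.mtotally_bounded (X.mcball b r)"
    unfolding X.mtotally_bounded_def
  proof (intro allI impI)
    fix \<epsilon> :: real assume "\<epsilon> > 0"
    define \<delta> where "\<delta> = \<epsilon> / 5"
    have \<delta>: "\<delta> > 0" using \<open>\<epsilon> > 0\<close> by (simp add: \<delta>_def)
    obtain n R where R: "R \<subseteq> mcball_of (Xs n) (bs n) r \<times> mcball_of X b r"
      and dense: "\<And>q. q \<in> mcball_of X b r \<Longrightarrow> \<exists>(u, v)\<in>R. mdist X q v \<le> \<delta>"
      and dist: "\<And>u v u' v'. (u, v) \<in> R \<Longrightarrow> (u', v') \<in> R
                   \<Longrightarrow> \<bar>mdist (Xs n) u u' - mdist X v v'\<bar> < \<delta>"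
      by (rule pointed_GH_approximation[OF conv r \<delta>], rule that) (assumption | blast)+
    interpret Xn: Metric_space "mspace (Xs n)" "mdist (Xs n)" by simp
    have "compactin Xn.mtopology (Xn.mcball (bs n) r)"
      using proper[of n] Xn.closedin_mcball Xn.mbounded_mcball
      unfolding proper_metric_def mtopology_of_def by blast
    then have "Xn.mtotally_bounded (Xn.mcball (bs n) r)"
      by (rule Xn.compactin_imp_mtotally_bounded)
    then have "0 < \<delta> \<longrightarrow> (\<exists>K. finite K \<and> K \<subseteq> Xn.mcball (bs n) r \<and>
        Xn.mcball (bs n) r \<subseteq> (\<Union>x\<in>K. Xn.mball x \<delta>))"
      unfolding Xn.mtotally_bounded_def by (rule spec)
    with \<delta> obtain K where K: "finite K" "K \<subseteq> Xn.mcball (bs n) r"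
      "Xn.mcball (bs n) r \<subseteq> (\<Union>x\<in>K. Xn.mball x \<delta>)"
      by (elim impE exE conjE)
    define L where "L = {k \<in> K. \<exists>p\<in>R. mdist (Xs n) k (fst p) < \<delta>}"
    have "\<forall>k\<in>L. \<exists>p. p \<in> R \<and> mdist (Xs n) k (fst p) < \<delta>" by (auto simp: L_def)
    then obtain t where t: "\<And>k. k \<in> L \<Longrightarrow> t k \<in> R \<and> mdist (Xs n) k (fst (t k)) < \<delta>"
      by metis
    show "\<exists>K. finite K \<and> K \<subseteq> X.mcball b r \<and> X.mcball b r \<subseteq> (\<Union>x\<in>K. X.mball x \<epsilon>)"
    proof (intro exI conjI)
      show "finite ((snd \<circ> t) ` L)" using K(1) by (simp add: L_def)
      show "(snd \<circ> t) ` L \<subseteq> X.mcball b r"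
        using t R by (fastforce simp: mcball_of_def)
      show "X.mcball b r \<subseteq> (\<Union>x\<in>(snd \<circ> t) ` L. X.mball x \<epsilon>)"
      proof
        fix q assume q: "q \<in> X.mcball b r"
        then obtain u v where uv: "(u, v) \<in> R" "mdist X q v \<le> \<delta>"
          using dense[of q] by (auto simp: mcball_of_def)
        then have mem: "u \<in> Xn.mcball (bs n) r" "v \<in> mspace X"
          using R by (auto simp: mcball_of_def)
        then obtain k where k: "k \<in> K" "mdist (Xs n) k u < \<delta>" using K(3) by fastforce
        then have kL: "k \<in> L" using uv(1) by (force simp: L_def)
        obtain u' v' where t': "t k = (u', v')" by (cases "t k")
        then have u'v': "(u', v') \<in> R" "mdist (Xs n) k u' < \<delta>" using t[OF kL] by auto
        have mem': "u' \<in> mspace (Xs n)" "u \<in> mspace (Xs n)" "k \<in> mspace (Xs n)" "v' \<in> mspace X"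
          using u'v' R mem k(1) K(2) by (auto simp: mcball_of_def)
        have "mdist (Xs n) u' u \<le> mdist (Xs n) u' k + mdist (Xs n) k u"
          using mem' by (intro mdist_triangle) auto
        moreover have "mdist X v' q \<le> mdist X v' v + mdist X v q"
          using mem mem' q by (intro mdist_triangle) auto
        ultimately have "mdist X v' q < \<epsilon>"
          using dist[OF u'v'(1) uv(1)] uv(2) k(2) u'v'(2) \<delta>
            mdist_commute[of X q v] mdist_commute[of "Xs n" u' k] \<delta>_def
          by linarith
        then show "q \<in> (\<Union>x\<in>(snd \<circ> t) ` L. X.mball x \<epsilon>)"
          using kL t' mem' q by force
      qed
    qed
  qed
  moreover have "X.mcomplete" using complete by (simp add: mcomplete_of_def)
  moreover have "X.mtopology closure_of X.mcball b r = X.mcball b r"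
    by (simp add: closure_of_eq)
  ultimately show ?thesis
    using X.mtotally_bounded_eq_compact_closure_of
    by (metis mcball_of_def mtopology_of_def)
qed

lemma mcball_compactin_if_base_balls_compactin:
  fixes X :: "'b metric"
  assumes b: "b \<in> mspace X"
    and cpt: "\<And>r. r > 0 \<Longrightarrow> compactin (mtopology_of X) (mcball_of X b r)"
  shows "compactin (mtopology_of X) (mcball_of X x s)"
proof -
  interpret X: Metric_space "mspace X" "mdist X" by simp
  define r where "r = mdist X b x + \<bar>s\<bar> + 1"
  have "compactin (mtopology_of X) (mcball_of X b r)"
    using cpt[of r] mdist_nonneg[of X b x] by (simp add: r_def add_nonneg_pos)
  moreover have "mcball_of X x s \<subseteq> mcball_of X b r"
  proof
    fix y assume y: "y \<in> mcball_of X x s"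
    then have "mdist X b y \<le> mdist X b x + mdist X x y" using b by (intro mdist_triangle) auto
    then show "y \<in> mcball_of X b r" using y b by (auto simp: r_def)
  qed
  moreover have "closedin (mtopology_of X) (mcball_of X x s)"
    by (simp add: mtopology_of_def mcball_of_def)
  ultimately show ?thesis by (rule closed_compactin)
qed

section \<open>From finite families to extensions\<close>

text \<open>The finite intersection property is applied to all enlargements of all balls at once, so the
  single application of compactness also gets rid of the enlargements.\<close>

lemma common_point_by_compactness:
  fixes X :: "'b metric"
  assumes ne: "mspace X \<noteq> {}"
    and cpt: "\<And>x s. compactin (mtopology_of X) (mcball_of X x s)"
    and fin: "\<And>B \<epsilon>. finite B \<Longrightarrow> linked_balls X B \<Longrightarrow> \<epsilon> > 0
                \<Longrightarrow> \<exists>z. common_point X ((\<lambda>(x, r). (x, r + \<epsilon>)) ` B) z"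
    and B: "linked_balls X B"
  obtains z where "common_point X B z"
proof (cases "B = {}")
  case True
  then show thesis using ne that by (auto simp: common_point_def)
next
  case False
  then obtain x0 r0 where x0: "(x0, r0) \<in> B" by auto
  define ball where "ball = (\<lambda>((x, r), e). mcball_of X x (r + e))"
  let ?P = "B \<times> {0::real<..}" and ?K = "mcball_of X x0 (r0 + 1)"
  have "?K \<inter> \<Inter> \<F> \<noteq> {}" if \<F>: "finite \<F>" "\<F> \<subseteq> ball ` ?P" for \<F>
  proof -
    obtain P where P: "P \<subseteq> ?P" "finite P" "\<F> = ball ` P"
      using finite_subset_image[OF \<F>] by blast
    define e where "e = Min (insert 1 (snd ` P))"
    have e: "e > 0" "e \<le> 1" "\<And>p. p \<in> P \<Longrightarrow> e \<le> snd p"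
      using P by (auto simp: e_def)
    have "linked_balls X (insert (x0, r0) (fst ` P))"
      using P(1) x0 by (intro linked_balls_subset[OF B]) auto
    then obtain z where z: "common_point X ((\<lambda>(x, r). (x, r + e)) ` insert (x0, r0) (fst ` P)) z"
      using fin[of "insert (x0, r0) (fst ` P)" e] P(2) e(1) by auto
    have near: "mdist X x z \<le> r + e" if "(x, r) \<in> insert (x0, r0) (fst ` P)" for x r
      using z that mdist_commute[of X x z] by (fastforce simp: common_point_def)
    have mem: "x \<in> mspace X" if "(x, r) \<in> B" for x r
      using B that by (force simp: linked_balls_def)
    have zX: "z \<in> mspace X" using z by (simp add: common_point_def)
    have "z \<in> ?K" using near[of x0 r0] e(2) zX mem[OF x0] by simp
    moreover have "z \<in> ball p" if "p \<in> P" for p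
    proof -
      obtain x r d where p: "p = ((x, r), d)" by (metis prod.exhaust)
      have "mdist X x z \<le> r + e" by (rule near) (use that p in force)
      moreover have "x \<in> mspace X" using P(1) that p mem by blast
      ultimately show ?thesis using e(3)[OF that] p zX by (simp add: ball_def)
    qed
    ultimately show ?thesis using P(3) by blast
  qed
  moreover have "closedin (mtopology_of X) C" if "C \<in> ball ` ?P" for C
    using that by (auto simp: ball_def mcball_of_def mtopology_of_def Metric_space.closedin_mcball)
  ultimately have "?K \<inter> \<Inter> (ball ` ?P) \<noteq> {}"
    using cpt[of x0 "r0 + 1"] unfolding compactin_fip by blast
  then obtain z where z: "z \<in> ?K" "\<And>p. p \<in> ?P \<Longrightarrow> z \<in> ball p" by blast
  have "mdist X z x \<le> r" if "(x, r) \<in> B" for x r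
  proof (rule field_le_epsilon)
    fix e :: real assume "e > 0"
    then show "mdist X z x \<le> r + e"
      using z(2)[of "((x, r), e)"] that by (simp add: ball_def mdist_commute)
  qed
  then show thesis using z(1) that[of z] by (auto simp: common_point_def)
qed

text \<open>Partial extensions are represented by their graphs. Single-valuedness comes for free: two
  values over one point of \<open>C\<close> have distance at most zero. A maximal graph is defined
  everywhere, because the balls about its values \<open>x\<close> over \<open>c\<close> of radius \<open>d c c'\<close> are
  linked by the triangle inequality through a missing point \<open>c'\<close>, and a common point of
  them is an admissible value at \<open>c'\<close>.\<close>

lemma injective_metric_if_linked_balls_meet:
  fixes X :: "'b metric"
  assumes meet: "\<And>B. linked_balls X B \<Longrightarrow> \<exists>z. common_point X B z"
  shows "injective_metric TYPE('e) TYPE('f) X"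
  unfolding injective_metric_def
proof (intro allI impI, elim conjE)
  fix A :: "'e metric" and C :: "'f metric" and i f
  assume i: "isometric_embedding A C i" and f: "nonexpansive_map A X f"
  define G0 where "G0 = (\<lambda>a. (i a, f a)) ` mspace A"
  define \<G> where "\<G> = {G. G \<subseteq> mspace C \<times> mspace X \<and>
      (\<forall>(c, x)\<in>G. \<forall>(c', x')\<in>G. mdist X x x' \<le> mdist C c c')}"
  define \<A> where "\<A> = {G \<in> \<G>. G0 \<subseteq> G}"
  have "G0 \<in> \<A>"
    using i f unfolding \<A>_def \<G>_def G0_def isometric_embedding_def nonexpansive_map_def
    by auto
  have "\<exists>M\<in>\<A>. \<forall>G\<in>\<A>. M \<subseteq> G \<longrightarrow> G = M"
  proof (rule subset_Zorn_nonempty)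
    show "\<A> \<noteq> {}" using \<open>G0 \<in> \<A>\<close> by blast
    fix \<C> assume \<C>: "\<C> \<noteq> {}" "subset.chain \<A> \<C>"
    have sub: "\<C> \<subseteq> \<A>" using \<C>(2) by (simp add: subset_chain_def)
    have "mdist X x x' \<le> mdist C c c'"
      if in_Union: "(c, x) \<in> \<Union>\<C>" "(c', x') \<in> \<Union>\<C>" for c x c' x'
    proof -
      obtain G G' where "G \<in> \<C>" "(c, x) \<in> G" "G' \<in> \<C>" "(c', x') \<in> G'"
        using in_Union by blast
      then obtain H where "H \<in> \<C>" "(c, x) \<in> H" "(c', x') \<in> H"
        using \<C>(2) unfolding subset_chain_def by blast
      moreover have "H \<in> \<G>" using sub calculation(1) by (auto simp: \<A>_def)
      ultimately show ?thesis unfolding \<G>_def by fast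
    qed
    moreover have "\<Union>\<C> \<subseteq> mspace C \<times> mspace X"
      using sub unfolding \<A>_def \<G>_def by blast
    moreover have "G0 \<subseteq> \<Union>\<C>"
      using sub \<C>(1) unfolding \<A>_def by blast
    ultimately show "\<Union>\<C> \<in> \<A>"
      unfolding \<A>_def \<G>_def by blast
  qed
  then obtain M where M: "M \<in> \<A>" and max: "\<And>G. G \<in> \<A> \<Longrightarrow> M \<subseteq> G \<Longrightarrow> G = M" by blast
  have M_mem: "c \<in> mspace C" "x \<in> mspace X" if "(c, x) \<in> M" for c x
    using M that unfolding \<A>_def \<G>_def by auto
  have M_le: "mdist X x x' \<le> mdist C c c'" if "(c, x) \<in> M" "(c', x') \<in> M" for c x c' x'
    using M that unfolding \<A>_def \<G>_def by blast
  have total: "\<exists>x. (c, x) \<in> M" if c: "c \<in> mspace C" for c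
  proof -
    have "linked_balls X ((\<lambda>(c', x). (x, mdist C c' c)) ` M)"
    proof -
      have "mdist X x x' \<le> mdist C c1 c + mdist C c2 c" if "(c1, x) \<in> M" "(c2, x') \<in> M" for c1 x c2 x'
        using M_le[OF that] mdist_triangle[of c1 C c c2] c M_mem that mdist_commute[of C c2 c]
        by fastforce
      then show ?thesis using M_mem(2) by (auto simp: linked_balls_def)
    qed
    then obtain z where z: "common_point X ((\<lambda>(c', x). (x, mdist C c' c)) ` M) z"
      using meet by blast
    have zX: "z \<in> mspace X" using z by (simp add: common_point_def)
    have near: "mdist X z x \<le> mdist C c c'" "mdist X x z \<le> mdist C c' c" if "(c', x) \<in> M" for c' x
      using z that mdist_commute[of C c c'] mdist_commute[of X x z]
      by (fastforce simp: common_point_def)+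
    have "mdist X z z \<le> mdist C c c" using mdist_zero[OF zX zX] by simp
    then have "insert (c, z) M \<in> \<G>"
      unfolding \<G>_def using M_mem M_le near c zX by auto
    then have "insert (c, z) M \<in> \<A>" using M by (auto simp: \<A>_def)
    then have "insert (c, z) M = M" by (rule max) blast
    then show ?thesis by blast
  qed
  then obtain F where F: "\<And>c. c \<in> mspace C \<Longrightarrow> (c, F c) \<in> M" by metis
  show "\<exists>F. nonexpansive_map C X F \<and> (\<forall>a\<in>mspace A. F (i a) = f a)"
  proof (intro exI conjI ballI)
    show "nonexpansive_map C X F"
      using M_mem(2)[OF F] M_le[OF F F] by (auto simp: nonexpansive_map_def)
    fix a assume a: "a \<in> mspace A"
    then have ia: "i a \<in> mspace C" using i by (auto simp: isometric_embedding_def)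
    have "(i a, f a) \<in> M" using M a by (auto simp: \<A>_def G0_def)
    then have "mdist X (F (i a)) (f a) \<le> mdist C (i a) (i a)" "f a \<in> mspace X" "F (i a) \<in> mspace X"
      using F[OF ia] M_le M_mem by blast+
    then show "F (i a) = f a" using ia mdist_nonneg[of X "F (i a)" "f a"]
      by (metis mdist_zero order_antisym)
  qed
qed

theorem lemma1p5p2:
  fixes Xs :: "nat \<Rightarrow> 'a metric" and bs :: "nat \<Rightarrow> 'a"
    and X :: "'b metric" and b :: 'b
  assumes "\<And>n. bs n \<in> mspace (Xs n)"
    and "\<And>n. proper_metric (Xs n)"
    and "\<And>n. injective_metric TYPE('c::infinite) TYPE('d::infinite) (Xs n)"
    and "b \<in> mspace X"
    and "mcomplete_of X"
    and "pointed_GH_converges Xs bs X b"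
  shows "injective_metric TYPE('e) TYPE('f) X"
proof (rule injective_metric_if_linked_balls_meet)
  have cpt: "compactin (mtopology_of X) (mcball_of X x s)" for x s
    using mcball_compactin_if_base_balls_compactin[OF assms(4)]
      limit_ball_compactin[OF assms(2,5,6)] by blast
  have fin: "\<exists>z. common_point X ((\<lambda>(x, r). (x, r + \<epsilon>)) ` B) z"
    if "finite B" "linked_balls X B" "\<epsilon> > 0" for B \<epsilon>
    using limit_common_point_finite_enlarged[OF assms(1,3,4,6) that] by blast
  show "\<exists>z. common_point X B z" if "linked_balls X B" for B
    using common_point_by_compactness[OF _ cpt fin that] assms(4) by blast
qed

end
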